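(* Let $R$ and $S$ be finite commutative rings with nonzero identity, each of which is weakly nil clean but not nil clean. Then the diameter $diam(G_{WN}(R\times S))$ of the weakly nil clean graph of $R\times S$ is either $2$ or $3$.
   Context: For a ring $R$, $Idem(R)$ is the set of idempotents and $Nil(R)$ the set of nilpotent elements of $R$. An element $x\in R$ is nil clean if $x=n+e$ for some $e\in Idem(R)$ and $n\in Nil(R)$; it is weakly nil clean if $x=n+e$ or $x=n-e$ for some $e\in Idem(R)$ and $n\in Nil(R)$. The ring $R$ is nil clean (respectively weakly nil clean) if every element of $R$ is nil clean (respectively weakly nil clean). The weakly nil clean graph $G_{WN}(R)$ is the simple undirected graph (no loops) with vertex set $R$, in which two distinct vertices $x,y$ are adjacent if and only if $x+y$ is a weakly nil clean element of $R$. The distance between two vertices is the number of edges on a shortest path between them ($\infty$ if there is no path), and the diameter of a graph is the maximum of the distances over all pairs of distinct vertices. *)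

theory Defs
  imports
    "HOL-Algebra.Chinese_Remainder"
    "Graph_Theory.Graph_Theory"
begin

definition idempotents :: "('a, 'm) ring_scheme \<Rightarrow> 'a set" where
  "idempotents R = {e \<in> carrier R. e \<otimes>\<^bsub>R\<^esub> e = e}"

definition nilpotents :: "('a, 'm) ring_scheme \<Rightarrow> 'a set" where
  "nilpotents R = {a \<in> carrier R. \<exists>k::nat. k > 0 \<and> a [^]\<^bsub>R\<^esub> k = \<zero>\<^bsub>R\<^esub>}"

definition nil_clean_elem :: "('a, 'm) ring_scheme \<Rightarrow> 'a \<Rightarrow> bool" where
  "nil_clean_elem R x \<longleftrightarrow> (\<exists>n \<in> nilpotents R. \<exists>e \<in> idempotents R. x = n \<oplus>\<^bsub>R\<^esub> e)"

definition weakly_nil_clean_elem :: "('a, 'm) ring_scheme \<Rightarrow> 'a \<Rightarrow> bool" where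
  "weakly_nil_clean_elem R x \<longleftrightarrow>
     (\<exists>n \<in> nilpotents R. \<exists>e \<in> idempotents R. x = n \<oplus>\<^bsub>R\<^esub> e \<or> x = n \<ominus>\<^bsub>R\<^esub> e)"

definition nil_clean_ring :: "('a, 'm) ring_scheme \<Rightarrow> bool" where
  "nil_clean_ring R \<longleftrightarrow> (\<forall>x \<in> carrier R. nil_clean_elem R x)"

definition weakly_nil_clean_ring :: "('a, 'm) ring_scheme \<Rightarrow> bool" where
  "weakly_nil_clean_ring R \<longleftrightarrow> (\<forall>x \<in> carrier R. weakly_nil_clean_elem R x)"

text \<open>
  An undirected edge between \<open>x\<close> and \<open>y\<close> is represented by the two arcs \<open>(x, y)\<close> and \<open>(y, x)\<close>.
\<close>

definition weakly_nil_clean_graph :: "('a, 'm) ring_scheme \<Rightarrow> 'a pair_pre_digraph" where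
  "weakly_nil_clean_graph R =
     \<lparr> pverts = carrier R,
       parcs = {(x, y). x \<in> carrier R \<and> y \<in> carrier R \<and> x \<noteq> y \<and>
                        weakly_nil_clean_elem R (x \<oplus>\<^bsub>R\<^esub> y)} \<rparr>"

lemma pair_graph_weakly_nil_clean_graph:
  assumes "cring R" and "finite (carrier R)"
  shows "pair_graph (weakly_nil_clean_graph R)"
proof -
  interpret cring R by fact
  have "parcs (weakly_nil_clean_graph R) \<subseteq> carrier R \<times> carrier R"
    by (auto simp: weakly_nil_clean_graph_def)
  then have "finite (parcs (weakly_nil_clean_graph R))"
    using assms(2) by (meson finite_SigmaI finite_subset)
  then show ?thesis
    using assms(2)
    by unfold_locales
      (auto simp: weakly_nil_clean_graph_def symmetric_def sym_def a_comm)
qed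

text \<open>
  With unit arc weights, the shortest-path cost \<open>\<mu>\<close> is the usual graph distance: the least number
  of arcs on a path, and \<open>\<infinity>\<close> if there is no path.  The library definition of \<open>\<mu>\<close> ranges
  over walks; the lemma below shows that this gives the same value as ranging over paths.
\<close>

definition graph_distance :: "('a, 'b) pre_digraph \<Rightarrow> 'a \<Rightarrow> 'a \<Rightarrow> ereal" where
  "graph_distance G u v = wf_digraph.\<mu> G (\<lambda>_. 1) u v"

lemma graph_distance_eq_path_length:
  assumes "fin_digraph G"
  shows "graph_distance G u v =
           (INF p \<in> {p. pre_digraph.apath G u p v}. ereal (real (length p)))"
proof -
  interpret fin_digraph G by fact
  have cost: "awalk_cost (\<lambda>_. 1) p = real (length p)" for p :: "'b list"
    by (induct p) auto
  have le: "\<mu> (\<lambda>_. 1) u v \<le> (INF p \<in> {p. apath u p v}. ereal (real (length p)))"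
    using min_cost_le_walk_cost[of u _ v "\<lambda>_. 1"]
    by (auto simp: apath_def cost intro!: INF_greatest)
  have ge: "(INF p \<in> {p. apath u p v}. ereal (real (length p))) \<le> \<mu> (\<lambda>_. 1) u v"
  proof (cases "u \<rightarrow>\<^sup>*\<^bsub>G\<^esub> v")
    case True
    then obtain p where "apath u p v" "\<mu> (\<lambda>_. 1) u v = awalk_cost (\<lambda>_. 1) p"
      using min_cost_awalk[of u v "\<lambda>_. 1"] by auto
    then show ?thesis by (auto simp: cost intro: INF_lower)
  next
    case False
    then show ?thesis by (simp add: shortest_path_inf)
  qed
  show ?thesis
    unfolding graph_distance_def using le ge by (rule antisym)
qed

definition graph_diameter :: "('a, 'b) pre_digraph \<Rightarrow> ereal" where
  "graph_diameter G =
     Sup {graph_distance G u v | u v. u \<in> verts G \<and> v \<in> verts G \<and> u \<noteq> v}"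

end

theory Submission
  imports Defs
begin

text \<open>
  The diameter is in fact always \<open>2\<close>.  Everything rests on two observations: an element \<open>x\<close> is
  weakly nil clean iff \<open>x\<close> or \<open>\<ominus>x\<close> is nil clean (\<open>weakly_nil_clean_elem_iff\<close>), and a pair is nil
  clean iff both of its coordinates are (\<open>nil_clean_elem_RDirProd\<close>).  So a pair is weakly nil clean
  iff its two coordinates become nil clean with one \<^emph>\<open>common\<close> choice of sign.

  For the upper bound, every two elements \<open>a\<close>, \<open>b\<close> of a weakly nil clean ring admit a \<open>w\<close> with both
  \<open>a \<oplus> w\<close> and \<open>w \<oplus> b\<close> nil clean, namely \<open>w = \<ominus>a\<close> or \<open>w = \<ominus>b\<close>
  (\<open>weakly_nil_clean_common_summand\<close>).  Because the sign is always \<open>+\<close> here, such elements can be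
  chosen independently in \<open>R\<close> and in \<open>S\<close> and combined into a common neighbour of two given vertices
  of the product, unless that common neighbour is one of the two vertices, in which case these are
  adjacent.

  For the lower bound, take \<open>r \<in> R\<close> and \<open>s \<in> S\<close> that are not nil clean.  The pair \<open>(r, \<ominus>s)\<close> is not
  weakly nil clean, as the sign \<open>+\<close> fails in the first coordinate and the sign \<open>-\<close> in the second.
  Hence it is not adjacent to zero.
\<close>

section \<open>Nil clean elements and signs\<close>

context ring
begin

lemma zero_nil_clean: "nil_clean_elem R \<zero>"
proof -
  have "\<zero> \<in> nilpotents R"
    by (auto simp: nilpotents_def intro: exI[of _ "1::nat"])
  moreover have "\<zero> \<in> idempotents R"
    by (simp add: idempotents_def)
  ultimately show ?thesis
    unfolding nil_clean_elem_def by (metis l_zero zero_closed)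
qed

lemma minus_nilpotent:
  assumes "n \<in> nilpotents R"
  shows "\<ominus> n \<in> nilpotents R"
proof -
  from assms obtain k :: nat where n: "n \<in> carrier R" and k: "k > 0" "n [^] k = \<zero>"
    by (auto simp: nilpotents_def)
  have "(\<ominus> n) [^] i = n [^] i \<or> (\<ominus> n) [^] i = \<ominus> (n [^] i)" for i :: nat
    using n by (induction i) (auto simp: l_minus r_minus)
  from this[of k] have "(\<ominus> n) [^] k = \<zero>"
    using k by auto
  then show ?thesis
    using n k(1) by (auto simp: nilpotents_def)
qed

text \<open>
  Negation exchanges the two forms \<open>n \<oplus> e\<close> and \<open>n \<ominus> e\<close>, because it preserves nilpotency of \<open>n\<close>.
\<close>

lemma weakly_nil_clean_elem_iff:
  assumes x: "x \<in> carrier R"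
  shows "weakly_nil_clean_elem R x \<longleftrightarrow> nil_clean_elem R x \<or> nil_clean_elem R (\<ominus> x)"
proof
  assume "weakly_nil_clean_elem R x"
  then obtain n e where n: "n \<in> nilpotents R" and e: "e \<in> idempotents R"
    and ne: "x = n \<oplus> e \<or> x = n \<ominus> e"
    by (auto simp: weakly_nil_clean_elem_def)
  have c: "n \<in> carrier R" "e \<in> carrier R"
    using n e by (auto simp: nilpotents_def idempotents_def)
  from ne show "nil_clean_elem R x \<or> nil_clean_elem R (\<ominus> x)"
  proof
    assume "x = n \<oplus> e"
    with n e show ?thesis by (auto simp: nil_clean_elem_def)
  next
    assume "x = n \<ominus> e"
    then have "\<ominus> x = \<ominus> n \<oplus> e"
      using c by (simp add: minus_eq minus_add)
    with minus_nilpotent[OF n] e show ?thesis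
      by (auto simp: nil_clean_elem_def)
  qed
next
  assume "nil_clean_elem R x \<or> nil_clean_elem R (\<ominus> x)"
  then show "weakly_nil_clean_elem R x"
  proof
    assume "nil_clean_elem R x"
    then show ?thesis
      by (auto simp: nil_clean_elem_def weakly_nil_clean_elem_def)
  next
    assume "nil_clean_elem R (\<ominus> x)"
    then obtain n e where n: "n \<in> nilpotents R" and e: "e \<in> idempotents R"
      and ne: "\<ominus> x = n \<oplus> e"
      by (auto simp: nil_clean_elem_def)
    have c: "n \<in> carrier R" "e \<in> carrier R"
      using n e by (auto simp: nilpotents_def idempotents_def)
    have "x = \<ominus> (n \<oplus> e)"
      using x by (simp flip: ne)
    then have "x = \<ominus> n \<ominus> e"
      using c by (simp add: minus_eq minus_add)
    with minus_nilpotent[OF n] e show ?thesis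
      by (auto simp: weakly_nil_clean_elem_def)
  qed
qed

text \<open>
  Either \<open>b \<ominus> a\<close> or \<open>a \<ominus> b\<close> is nil clean.  With \<open>w = \<ominus>a\<close> the two sums are \<open>\<zero>\<close> and \<open>b \<ominus> a\<close>, with
  \<open>w = \<ominus>b\<close> they are \<open>a \<ominus> b\<close> and \<open>\<zero>\<close>.
\<close>

lemma weakly_nil_clean_common_summand:
  assumes R: "weakly_nil_clean_ring R" and a: "a \<in> carrier R" and b: "b \<in> carrier R"
  obtains w where "w \<in> carrier R" "nil_clean_elem R (a \<oplus> w)" "nil_clean_elem R (w \<oplus> b)"
proof -
  have "weakly_nil_clean_elem R (\<ominus> a \<oplus> b)"
    using R a b by (simp add: weakly_nil_clean_ring_def)
  then have "nil_clean_elem R (\<ominus> a \<oplus> b) \<or> nil_clean_elem R (a \<oplus> \<ominus> b)"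
    using a b by (simp add: weakly_nil_clean_elem_iff minus_add)
  then show thesis
  proof
    assume "nil_clean_elem R (\<ominus> a \<oplus> b)"
    then show thesis
      using a zero_nil_clean by (intro that[of "\<ominus> a"]) (simp_all add: r_neg)
  next
    assume "nil_clean_elem R (a \<oplus> \<ominus> b)"
    then show thesis
      using b zero_nil_clean by (intro that[of "\<ominus> b"]) (simp_all add: l_neg)
  qed
qed

end

section \<open>Nil clean elements of a direct product\<close>

lemma RDirProd_ops:
  "\<zero>\<^bsub>RDirProd R S\<^esub> = (\<zero>\<^bsub>R\<^esub>, \<zero>\<^bsub>S\<^esub>)"
  "\<one>\<^bsub>RDirProd R S\<^esub> = (\<one>\<^bsub>R\<^esub>, \<one>\<^bsub>S\<^esub>)"
  "(a, b) \<oplus>\<^bsub>RDirProd R S\<^esub> (c, d) = (a \<oplus>\<^bsub>R\<^esub> c, b \<oplus>\<^bsub>S\<^esub> d)"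
  "(a, b) \<otimes>\<^bsub>RDirProd R S\<^esub> (c, d) = (a \<otimes>\<^bsub>R\<^esub> c, b \<otimes>\<^bsub>S\<^esub> d)"
  by (simp_all add: RDirProd_def DirProd_def monoid.defs)

lemma RDirProd_nat_pow:
  "(a, b) [^]\<^bsub>RDirProd R S\<^esub> (k::nat) = (a [^]\<^bsub>R\<^esub> k, b [^]\<^bsub>S\<^esub> k)"
  by (induction k) (simp_all add: RDirProd_ops)

lemma RDirProd_minus:
  assumes "ring R" "ring S" "a \<in> carrier R" "b \<in> carrier S"
  shows "\<ominus>\<^bsub>RDirProd R S\<^esub> (a, b) = (\<ominus>\<^bsub>R\<^esub> a, \<ominus>\<^bsub>S\<^esub> b)"
proof -
  interpret R: ring R by fact
  interpret S: ring S by fact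
  interpret P: ring "RDirProd R S" using assms(1,2) by (rule RDirProd_ring)
  show ?thesis
    using assms(3,4)
    by (intro P.minus_equality) (auto simp: RDirProd_ops RDirProd_carrier R.l_neg S.l_neg)
qed

lemma idempotents_RDirProd: "idempotents (RDirProd R S) = idempotents R \<times> idempotents S"
  by (auto simp: idempotents_def RDirProd_carrier RDirProd_ops)

lemma (in ring) nat_pow_eq_zero_mono:
  assumes "a \<in> carrier R" "a [^] (k::nat) = \<zero>"
  shows "a [^] (k + l) = \<zero>"
  using assms by (simp flip: nat_pow_mult)

lemma nilpotents_RDirProd:
  assumes "ring R" "ring S"
  shows "nilpotents (RDirProd R S) = nilpotents R \<times> nilpotents S"
proof (intro equalityI subsetI)
  fix x assume "x \<in> nilpotents (RDirProd R S)"
  then show "x \<in> nilpotents R \<times> nilpotents S"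
    by (cases x) (auto simp: nilpotents_def RDirProd_carrier RDirProd_ops RDirProd_nat_pow)
next
  interpret R: ring R by fact
  interpret S: ring S by fact
  fix x assume "x \<in> nilpotents R \<times> nilpotents S"
  then obtain a b and k l :: nat where x: "x = (a, b)" "a \<in> carrier R" "b \<in> carrier S" "k > 0"
    and "a [^]\<^bsub>R\<^esub> k = \<zero>\<^bsub>R\<^esub>" "b [^]\<^bsub>S\<^esub> l = \<zero>\<^bsub>S\<^esub>"
    by (auto simp: nilpotents_def)
  then have "a [^]\<^bsub>R\<^esub> (k + l) = \<zero>\<^bsub>R\<^esub>" "b [^]\<^bsub>S\<^esub> (k + l) = \<zero>\<^bsub>S\<^esub>"
    using R.nat_pow_eq_zero_mono[of a k l] S.nat_pow_eq_zero_mono[of b l k]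
    by (simp_all add: add.commute)
  with x show "x \<in> nilpotents (RDirProd R S)"
    by (auto simp: nilpotents_def RDirProd_carrier RDirProd_ops RDirProd_nat_pow
        intro!: exI[of _ "k + l"])
qed

lemma nil_clean_elem_RDirProd:
  assumes "ring R" "ring S"
  shows "nil_clean_elem (RDirProd R S) (a, b) \<longleftrightarrow> nil_clean_elem R a \<and> nil_clean_elem S b"
  unfolding nil_clean_elem_def idempotents_RDirProd nilpotents_RDirProd[OF assms]
  by (auto simp: RDirProd_ops)

text \<open>
  The sign is shared by both coordinates, which is why a product of two weakly nil clean rings
  need not be weakly nil clean.
\<close>

lemma weakly_nil_clean_elem_RDirProd:
  assumes "ring R" "ring S" "a \<in> carrier R" "b \<in> carrier S"
  shows "weakly_nil_clean_elem (RDirProd R S) (a, b) \<longleftrightarrow>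
    nil_clean_elem R a \<and> nil_clean_elem S b \<or>
    nil_clean_elem R (\<ominus>\<^bsub>R\<^esub> a) \<and> nil_clean_elem S (\<ominus>\<^bsub>S\<^esub> b)"
proof -
  interpret P: ring "RDirProd R S" using assms(1,2) by (rule RDirProd_ring)
  show ?thesis
    using assms
    by (simp add: P.weakly_nil_clean_elem_iff RDirProd_carrier RDirProd_minus
        nil_clean_elem_RDirProd)
qed

section \<open>Distances and the diameter\<close>

text \<open>
  With unit weights the cost of a walk is its length, so distance bounds amount to exhibiting a
  short walk or excluding walks of length \<open>0\<close> and \<open>1\<close>.
\<close>

lemma (in wf_digraph) awalk_cost_unit: "awalk_cost (\<lambda>_. 1) p = real (length p)"
  by (induction p) auto

lemma graph_distance_le_length:
  assumes "wf_digraph G" "pre_digraph.awalk G u p v"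
  shows "graph_distance G u v \<le> ereal (real (length p))"
proof -
  interpret wf_digraph G by fact
  show ?thesis
    using min_cost_le_walk_cost[OF assms(2), of "\<lambda>_. 1"]
    by (simp add: graph_distance_def awalk_cost_unit)
qed

lemma graph_distance_ge_2:
  assumes "wf_digraph G" "u \<noteq> v" "(u, v) \<notin> arcs_ends G"
  shows "2 \<le> graph_distance G u v"
proof -
  interpret wf_digraph G by fact
  have "2 \<le> ereal (awalk_cost (\<lambda>_. 1) p)" if walk: "awalk u p v" for p
  proof (cases p rule: remdups_adj.cases)
    case 1
    with walk assms(2) show ?thesis by (simp add: awalk_Nil_iff)
  next
    case (2 e)
    with walk assms(3) show ?thesis by (auto simp: awalk_simps arcs_ends_conv)
  next
    case (3 e f q)
    then show ?thesis by (simp add: awalk_cost_unit)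
  qed
  then show ?thesis
    unfolding graph_distance_def \<mu>_def by (auto intro: INF_greatest)
qed

text \<open>
  A walk of length two through \<open>w\<close> may degenerate when \<open>w\<close> is an endpoint; this is why \<open>w\<close> is only
  required to have weakly nil clean sums with \<open>u\<close> and \<open>v\<close>, not to be adjacent to them.
\<close>

lemma weakly_nil_clean_graph_distance_le_2:
  fixes R :: "('a, 'm) ring_scheme"
  defines "G \<equiv> with_proj (weakly_nil_clean_graph R)"
  assumes wf: "wf_digraph G"
    and c: "u \<in> carrier R" "v \<in> carrier R" "w \<in> carrier R" and "u \<noteq> v"
    and sums: "weakly_nil_clean_elem R (u \<oplus>\<^bsub>R\<^esub> w)" "weakly_nil_clean_elem R (w \<oplus>\<^bsub>R\<^esub> v)"
  shows "graph_distance G u v \<le> 2"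
proof -
  interpret wf_digraph G by fact
  have arcs: "(x, y) \<in> arcs G"
    if "x \<in> carrier R" "y \<in> carrier R" "x \<noteq> y" "weakly_nil_clean_elem R (x \<oplus>\<^bsub>R\<^esub> y)" for x y
    using that by (simp add: G_def weakly_nil_clean_graph_def)
  have [simp]: "verts G = carrier R" "tail G = fst" "head G = snd"
    by (simp_all add: G_def weakly_nil_clean_graph_def)
  show ?thesis
  proof (cases "w = u \<or> w = v")
    case True
    with arcs c \<open>u \<noteq> v\<close> sums have "awalk u [(u, v)] v"
      by (auto simp: awalk_simps)
    from graph_distance_le_length[OF wf this] show ?thesis
      by (rule order_trans) simp
  next
    case False
    with arcs c sums have "awalk u [(u, w), (w, v)] v"
      by (auto simp: awalk_simps)
    from graph_distance_le_length[OF wf this] show ?thesis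
      by simp
  qed
qed

theorem theorem3p10:
  fixes R :: "('a, 'm) ring_scheme" and S :: "('b, 'n) ring_scheme"
  assumes "cring R" and "finite (carrier R)" and "\<one>\<^bsub>R\<^esub> \<noteq> \<zero>\<^bsub>R\<^esub>"
    and "weakly_nil_clean_ring R" and "\<not> nil_clean_ring R"
    and "cring S" and "finite (carrier S)" and "\<one>\<^bsub>S\<^esub> \<noteq> \<zero>\<^bsub>S\<^esub>"
    and "weakly_nil_clean_ring S" and "\<not> nil_clean_ring S"
  shows "graph_diameter (with_proj (weakly_nil_clean_graph (RDirProd R S))) = 2 \<or>
         graph_diameter (with_proj (weakly_nil_clean_graph (RDirProd R S))) = 3"
proof -
  interpret R: cring R by fact
  interpret S: cring S by fact
  note rings = R.ring_axioms S.ring_axioms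
  interpret P: ring "RDirProd R S" using rings by (rule RDirProd_ring)
  let ?P = "RDirProd R S"
  let ?G = "with_proj (weakly_nil_clean_graph ?P)"
  have wf: "wf_digraph ?G"
    by unfold_locales (auto simp: weakly_nil_clean_graph_def)
  have verts: "verts ?G = carrier R \<times> carrier S"
    by (simp add: weakly_nil_clean_graph_def RDirProd_carrier)

  have upper: "graph_distance ?G u v \<le> 2"
    if uv: "u \<in> verts ?G" "v \<in> verts ?G" "u \<noteq> v" for u v
  proof -
    obtain a b a' b' where u: "u = (a, b)" "a \<in> carrier R" "b \<in> carrier S"
      and v: "v = (a', b')" "a' \<in> carrier R" "b' \<in> carrier S"
      using uv(1,2) unfolding verts by blast
    obtain x where x: "x \<in> carrier R" "nil_clean_elem R (a \<oplus>\<^bsub>R\<^esub> x)"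
        "nil_clean_elem R (x \<oplus>\<^bsub>R\<^esub> a')"
      using R.weakly_nil_clean_common_summand[OF assms(4) u(2) v(2)] .
    obtain y where y: "y \<in> carrier S" "nil_clean_elem S (b \<oplus>\<^bsub>S\<^esub> y)"
        "nil_clean_elem S (y \<oplus>\<^bsub>S\<^esub> b')"
      using S.weakly_nil_clean_common_summand[OF assms(9) u(3) v(3)] .
    have "weakly_nil_clean_elem ?P (u \<oplus>\<^bsub>?P\<^esub> (x, y))"
      "weakly_nil_clean_elem ?P ((x, y) \<oplus>\<^bsub>?P\<^esub> v)"
      using u v x y by (simp_all add: RDirProd_ops weakly_nil_clean_elem_RDirProd[OF rings])
    then show ?thesis
      using u v x(1) y(1) uv(3)
      by (intro weakly_nil_clean_graph_distance_le_2[OF wf, where w = "(x, y)"])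
        (simp_all add: RDirProd_carrier)
  qed

  obtain r where r: "r \<in> carrier R" "\<not> nil_clean_elem R r"
    using assms(5) by (auto simp: nil_clean_ring_def)
  obtain s where s: "s \<in> carrier S" "\<not> nil_clean_elem S s"
    using assms(10) by (auto simp: nil_clean_ring_def)
  let ?z = "(\<zero>\<^bsub>R\<^esub>, \<zero>\<^bsub>S\<^esub>)" and ?t = "(r, \<ominus>\<^bsub>S\<^esub> s)"
  have "?z \<noteq> ?t"
    using r(2) R.zero_nil_clean by auto
  moreover have "\<not> weakly_nil_clean_elem ?P (?z \<oplus>\<^bsub>?P\<^esub> ?t)"
    using r s by (simp add: RDirProd_ops weakly_nil_clean_elem_RDirProd[OF rings])
  then have "(?z, ?t) \<notin> arcs_ends ?G"
    by (simp add: weakly_nil_clean_graph_def)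
  ultimately have lower: "2 \<le> graph_distance ?G ?z ?t"
    by (rule graph_distance_ge_2[OF wf])

  have "graph_diameter ?G = 2"
    unfolding graph_diameter_def
  proof (rule antisym)
    show "Sup {graph_distance ?G u v |u v. u \<in> verts ?G \<and> v \<in> verts ?G \<and> u \<noteq> v} \<le> 2"
      using upper by (auto intro: Sup_least)
    show "2 \<le> Sup {graph_distance ?G u v |u v. u \<in> verts ?G \<and> v \<in> verts ?G \<and> u \<noteq> v}"
      using r(1) s(1) \<open>?z \<noteq> ?t\<close> lower unfolding verts by (intro Sup_upper2[OF _ lower]) blast
  qed
  then show ?thesis ..
qed

end
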